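(* Let $\mathcal{S}=(S_1,\dots,S_n)$ be the ordered state list where $S_k$ is the state of having $k$ blue vertices in the complete graph $K_n$. The Markov transition matrix $M=[m_{ij}]:=M(K_n,\mathcal{S})$ of the probabilistic zero forcing process on $K_n$ with respect to $\mathcal{S}$ has \[ m_{ij}=\begin{cases} \binom{n-i}{j-i}\left(1-\left(\frac{n-1-i}{n-1}\right)^i\right)^{j-i}\left(\left(\frac{n-1-i}{n-1}\right)^i\right)^{n-j} & \text{if } i\le \min(n-2,j),\\ 1 & \text{if } j=n \text{ and } i=n-1 \text{ or } n,\\ 0 & \text{if } i>j \text{ or } i=j=n-1. \end{cases} \] Furthermore, \[\operatorname{spec}(M)=\left\{0,1,\left(\frac{n-1-i}{n-1}\right)^{i(n-i)}: i\in\{1,\dots,n-2\}\right\}.\]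
   Context: Graphs are finite, simple and undirected. $N[u]=N(u)\cup\{u\}$ is the closed neighborhood of $u$. Probabilistic zero forcing: each vertex of a connected graph $G$ is blue or white. In one round, with $C$ the set of vertices that are blue at the start of the round, every blue vertex $u$ attempts to force each of its white neighbors $w$, all attempts being independent, each succeeding with probability $\Pr(u\to w)=\frac{|N[u]\cap C|}{\deg u}$. A white vertex becomes blue in the round if at least one blue neighbor succeeds in forcing it; blue vertices stay blue. $K_n$ is the complete graph on $n$ vertices, and the process is started with one blue vertex. $M(K_n,\mathcal{S})$ is the $n\times n$ matrix whose $(i,j)$ entry is the probability that, starting a round with exactly $i$ blue vertices in $K_n$, there are exactly $j$ blue vertices at the end of that round. $\operatorname{spec}(M)$ denotes the spectrum (the eigenvalues) of $M$. *)

theory Defs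
  imports
    "HOL-Probability.Product_PMF"
    "Jordan_Normal_Form.Spectral_Radius"
    "Graph_Theory.Kuratowski"
begin

(* A finite simple undirected graph is a "graph" of Graph_Theory: a finite symmetric digraph
   without loops or multiple arcs. Each edge is a pair of opposite arcs, so the degree of a
   vertex is its out_degree. *)

definition nbhd :: "('a,'b) pre_digraph \<Rightarrow> 'a \<Rightarrow> 'a set" where
  "nbhd G u = {w. u \<rightarrow>\<^bsub>G\<^esub> w}"

definition closed_nbhd :: "('a,'b) pre_digraph \<Rightarrow> 'a \<Rightarrow> 'a set" where
  "closed_nbhd G u = insert u (nbhd G u)"

definition force_prob :: "('a,'b) pre_digraph \<Rightarrow> 'a set \<Rightarrow> 'a \<Rightarrow> real" where
  "force_prob G C u = real (card (closed_nbhd G u \<inter> C)) / real (out_degree G u)"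

(* The pairs (u, w) such that the blue vertex u attempts to force its white neighbor w. *)
definition attempts :: "('a,'b) pre_digraph \<Rightarrow> 'a set \<Rightarrow> ('a \<times> 'a) set" where
  "attempts G C = {(u, w). u \<in> C \<and> w \<in> nbhd G u \<and> w \<notin> C}"

(* Distribution of the set of blue vertices at the end of a round that starts with blue set C.
   Pi_pmf makes the attempts independent. A white neighbor w of a blue vertex u is not in C,
   so force_prob G C u is at most 1 for every attempt and bernoulli_pmf does not truncate it. *)
definition pzf_round :: "('a,'b) pre_digraph \<Rightarrow> 'a set \<Rightarrow> 'a set pmf" where
  "pzf_round G C =
     map_pmf (\<lambda>success. C \<union> {w. \<exists>u. (u, w) \<in> attempts G C \<and> success (u, w)})
       (Pi_pmf (attempts G C) False (\<lambda>(u, w). bernoulli_pmf (force_prob G C u)))"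

(* A state is a set of configurations (a configuration is the set of blue vertices). *)
definition blue_count_state :: "('a,'b) pre_digraph \<Rightarrow> nat \<Rightarrow> 'a set set" where
  "blue_count_state G k = {C. C \<subseteq> verts G \<and> card C = k}"

definition blue_count_states :: "('a,'b) pre_digraph \<Rightarrow> 'a set set list" where
  "blue_count_states G = map (blue_count_state G) [1..<card (verts G) + 1]"

(* The entry at (i, j) is the common value, over all configurations C in the i-th state, of the
   probability that a round started from C ends in the j-th state. It is only meaningful if
   this probability does not depend on the choice of C. Rows and columns count from 0. *)
definition pzf_matrix :: "('a,'b) pre_digraph \<Rightarrow> 'a set set list \<Rightarrow> real mat" where
  "pzf_matrix G Ss = mat (length Ss) (length Ss)
     (\<lambda>(i, j). THE p. \<forall>C \<in> Ss ! i. measure_pmf.prob (pzf_round G C) (Ss ! j) = p)"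

end

theory Submission
  imports Defs
begin

text \<open>
  In the complete graph with \<open>i\<close> blue vertices every attempt succeeds with the same probability
  \<open>i / (n - 1)\<close>. Attempts at different white vertices are independent, so each of the \<open>n - i\<close> white
  vertices independently stays white with probability \<open>q = (1 - i / (n - 1)) ^ i\<close>, and the number of
  newly blue vertices is binomial with parameters \<open>n - i\<close> and \<open>1 - q\<close>. Blue vertices stay blue, so
  the matrix is upper triangular and its eigenvalues are the diagonal entries \<open>q ^ (n - i)\<close>.
\<close>

text \<open>Regrouping independent trials by their second coordinate gives independent rows, one per
  \<open>w\<close>. A row with \<open>w\<close> outside \<open>B\<close> is constantly
  \<open>d\<close>, which is why the outer default is \<open>\<lambda>_. d\<close>.\<close>

lemma Pi_pmf_Times_curry:
  fixes A :: "'a set" and B :: "'b set" and d :: 'c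
  assumes "finite A" "finite B"
  shows "map_pmf (\<lambda>g w u. g (u, w)) (Pi_pmf (A \<times> B) d p) =
         Pi_pmf B (\<lambda>_. d) (\<lambda>w. Pi_pmf A d (\<lambda>u. p (u, w)))"
proof (rule pmf_eqI)
  fix h :: "'b \<Rightarrow> 'a \<Rightarrow> 'c"
  let ?c = "\<lambda>(g :: 'a \<times> 'b \<Rightarrow> 'c) w u. g (u, w)" and ?g = "\<lambda>(u, w). h w u"
  have "inj ?c"
    by (rule injI) (auto simp: fun_eq_iff)
  \<comment> \<open>Currying is injective, so the mass at \<open>h\<close> is the mass at its only
    preimage \<open>?g\<close>.\<close>
  then have "pmf (map_pmf ?c (Pi_pmf (A \<times> B) d p)) h = pmf (Pi_pmf (A \<times> B) d p) ?g"
    using pmf_map_inj'[of ?c "Pi_pmf (A \<times> B) d p" ?g] by simp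
  also have "\<dots> = pmf (Pi_pmf B (\<lambda>_. d) (\<lambda>w. Pi_pmf A d (\<lambda>u. p (u, w)))) h"
  proof (cases "\<forall>x. x \<notin> A \<times> B \<longrightarrow> ?g x = d")
    case True
    then have "h w = (\<lambda>_. d)" if "w \<notin> B" for w
      using that by auto
    moreover have "h w u = d" if "u \<notin> A" for u w
      using True that by auto
    moreover have "(\<Prod>x\<in>A \<times> B. pmf (p x) (?g x)) = (\<Prod>w\<in>B. \<Prod>u\<in>A. pmf (p (u, w)) (h w u))"
      by (subst prod.swap, subst prod.cartesian_product) (auto intro: prod.cong)
    ultimately show ?thesis
      using assms True by (simp add: pmf_Pi)
  next
    case False
    then obtain u w where uw: "u \<notin> A \<or> w \<notin> B" "h w u \<noteq> d"
      by auto
    \<comment> \<open>Either row \<open>w\<close> violates the outer default, or its factor in the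
      product over \<open>B\<close> is zero; both give mass 0.\<close>
    then have "w \<notin> B \<and> h w \<noteq> (\<lambda>_. d) \<or> w \<in> B \<and> pmf (Pi_pmf A d (\<lambda>u. p (u, w))) (h w) = 0"
      using assms by (auto simp: pmf_Pi)
    then have "pmf (Pi_pmf B (\<lambda>_. d) (\<lambda>w. Pi_pmf A d (\<lambda>u. p (u, w)))) h = 0"
      using assms(2) by (auto simp: pmf_Pi[of B])
    moreover have "pmf (Pi_pmf (A \<times> B) d p) ?g = 0"
      using False assms by (intro pmf_Pi_outside) auto
    ultimately show ?thesis
      by simp
  qed
  finally show "pmf (map_pmf ?c (Pi_pmf (A \<times> B) d p)) h = \<dots>" .
qed

text \<open>No trial succeeds exactly when all \<open>card A\<close> independent trials
  fail.\<close>

lemma map_pmf_Bex_bernoulli: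
  assumes "finite A" "0 \<le> r" "r \<le> 1"
  shows "map_pmf (\<lambda>f. \<exists>u\<in>A. f u) (Pi_pmf A False (\<lambda>_. bernoulli_pmf r)) =
         bernoulli_pmf (1 - (1 - r) ^ card A)"
proof -
  let ?M = "map_pmf (\<lambda>f. \<exists>u\<in>A. f u) (Pi_pmf A False (\<lambda>_. bernoulli_pmf r))"
    and ?q = "(1 - r) ^ card A"
  have q: "0 \<le> ?q" "?q \<le> 1"
    using assms by (auto intro: power_le_one)
  have "pmf ?M False = measure_pmf.prob (Pi_pmf A False (\<lambda>_. bernoulli_pmf r)) (Pi A (\<lambda>_. {False}))"
    by (auto simp: pmf_map vimage_def Pi_def intro: arg_cong[where f = "measure_pmf.prob _"])
  also have "\<dots> = ?q"
    using assms by (simp add: measure_Pi_pmf_Pi measure_pmf_single)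
  finally have F: "pmf ?M False = ?q" .
  have T: "pmf ?M True = 1 - pmf ?M False"
    using sum_pmf_eq_1[OF finite subset_UNIV, of ?M] by (simp add: UNIV_bool)
  show ?thesis
  proof (rule pmf_eqI)
    show "pmf ?M b = pmf (bernoulli_pmf (1 - ?q)) b" for b
      using T F q by (cases b) simp_all
  qed
qed

text \<open>Trials with different targets \<open>w\<close> are independent, so the targets hit at
  least once are the successes of \<open>card B\<close> independent Bernoulli variables.\<close>

lemma map_pmf_card_forced_binomial:
  assumes "finite A" "finite B" "0 \<le> r" "r \<le> 1"
  shows "map_pmf (\<lambda>s. card {w \<in> B. \<exists>u\<in>A. s (u, w)}) (Pi_pmf (A \<times> B) False (\<lambda>_. bernoulli_pmf r)) =
         binomial_pmf (card B) (1 - (1 - r) ^ card A)"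
proof -
  have q: "1 - (1 - r) ^ card A \<in> {0..1}"
    using assms by (auto intro: power_le_one)
  have "binomial_pmf (card B) (1 - (1 - r) ^ card A) = map_pmf (\<lambda>f. card {w \<in> B. f w})
      (Pi_pmf B False (\<lambda>_. map_pmf (\<lambda>f. \<exists>u\<in>A. f u) (Pi_pmf A False (\<lambda>_. bernoulli_pmf r))))"
    by (simp add: binomial_pmf_altdef'[OF assms(2) refl q] map_pmf_Bex_bernoulli assms)
  also have "\<dots> = map_pmf (\<lambda>h. card {w \<in> B. \<exists>u\<in>A. h w u})
      (Pi_pmf B (\<lambda>_. False) (\<lambda>_. Pi_pmf A False (\<lambda>_. bernoulli_pmf r)))"
    \<comment> \<open>The map on each row moves out of the product because it sends the default row
      \<open>\<lambda>_. False\<close> to the default \<open>False\<close>.\<close>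
    using assms by (subst Pi_pmf_map[where dflt = "\<lambda>_. False"]) (auto simp: pmf.map_comp o_def)
  also have "\<dots> = map_pmf (\<lambda>s. card {w \<in> B. \<exists>u\<in>A. s (u, w)})
      (Pi_pmf (A \<times> B) False (\<lambda>_. bernoulli_pmf r))"
    using assms by (subst Pi_pmf_Times_curry[symmetric]) (auto simp: pmf.map_comp o_def)
  finally show ?thesis ..
qed

text \<open>The characteristic polynomial is the product of the linear factors given by the
  diagonal, and the spectrum is its set of roots.\<close>

lemma spectrum_upper_triangular:
  fixes A :: "'a :: field mat"
  assumes "A \<in> carrier_mat n n" "upper_triangular A"
  shows "spectrum A = (\<lambda>k. A $$ (k, k)) ` {0..<n}"
  using assms
  by (auto simp: spectrum_root_char_poly[OF assms(1)] char_poly_upper_triangular[OF assms]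
      poly_prod_list prod_list_zero_iff diag_mat_def o_def)

lemma complete_digraph_finite_verts: "K\<^bsub>n\<^esub> G \<Longrightarrow> finite (verts G)"
  by (auto simp: complete_digraph_def graph_def digraph_def intro: fin_digraph.finite_verts)

lemma complete_digraph_nbhd:
  assumes "K\<^bsub>n\<^esub> G" "u \<in> verts G"
  shows "nbhd G u = verts G - {u}"
  using assms by (auto simp: complete_digraph_def nbhd_def)

lemma complete_digraph_out_degree:
  assumes "K\<^bsub>n\<^esub> G" "u \<in> verts G"
  shows "out_degree G u = n - 1"
proof -
  interpret graph G
    using assms by (simp add: complete_digraph_def)
  \<comment> \<open>\<open>out_degree\<close> counts arcs; without parallel arcs the heads identify
    them, so it also counts neighbors.\<close>
  have "inj_on (head G) (out_arcs G u)"
    by (rule inj_onI) (auto simp: arc_to_ends_def intro: no_multi_arcs)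
  moreover have "head G ` out_arcs G u = nbhd G u"
    by (force simp: nbhd_def arcs_ends_conv)
  ultimately have "out_degree G u = card (verts G - {u})"
    by (metis assms card_image complete_digraph_nbhd out_degree_def)
  with assms show ?thesis
    by (simp add: complete_digraph_def)
qed

definition stay_white :: "nat \<Rightarrow> nat \<Rightarrow> real" where
  "stay_white n i = ((real n - 1 - real i) / (real n - 1)) ^ i"

text \<open>A binomial point mass at \<open>j - i\<close>. The guard is there because
  \<open>j - i\<close> truncates to 0 for \<open>j < i\<close>. With \<open>0 ^ 0 = 1\<close> the
  formula also covers the last two rows.\<close>

definition trans_prob :: "nat \<Rightarrow> nat \<Rightarrow> nat \<Rightarrow> real" where
  "trans_prob n i j = (if i \<le> j
     then real ((n - i) choose (j - i)) * (1 - stay_white n i) ^ (j - i) * stay_white n i ^ (n - j)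
     else 0)"

text \<open>The closed neighborhood of a blue vertex is the whole vertex set, so it contains all of
  \<open>C\<close> and every attempt has the same success probability.\<close>

lemma pzf_round_complete:
  assumes K: "K\<^bsub>n\<^esub> G" and C: "C \<subseteq> verts G"
  shows "pzf_round G C =
    map_pmf (\<lambda>s. C \<union> {w \<in> verts G - C. \<exists>u\<in>C. s (u, w)})
      (Pi_pmf (C \<times> (verts G - C)) False (\<lambda>_. bernoulli_pmf (real (card C) / real (n - 1))))"
proof -
  have att: "attempts G C = C \<times> (verts G - C)"
    using C by (auto simp: attempts_def complete_digraph_nbhd[OF K])
  have "force_prob G C u = real (card C) / real (n - 1)" if "u \<in> C" for u
  proof -
    have "closed_nbhd G u \<inter> C = C"
      using that C by (auto simp: closed_nbhd_def complete_digraph_nbhd[OF K subsetD[OF C that]])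
    then show ?thesis
      using that C by (auto simp: force_prob_def complete_digraph_out_degree[OF K])
  qed
  then have Pi: "Pi_pmf (attempts G C) False (\<lambda>(u, w). bernoulli_pmf (force_prob G C u)) =
    Pi_pmf (C \<times> (verts G - C)) False (\<lambda>_. bernoulli_pmf (real (card C) / real (n - 1)))"
    unfolding att by (intro Pi_pmf_cong) auto
  show ?thesis
    unfolding pzf_round_def Pi by (intro map_pmf_cong) (auto simp: att)
qed

lemma prob_pzf_round_complete:
  assumes K: "K\<^bsub>n\<^esub> G" and C: "C \<in> blue_count_state G i" and i: "1 \<le> i"
  shows "measure_pmf.prob (pzf_round G C) (blue_count_state G j) = trans_prob n i j"
proof -
  let ?V = "verts G" and ?r = "real i / real (n - 1)"
  have V: "finite ?V" "card ?V = n"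
    using K by (auto simp: complete_digraph_finite_verts complete_digraph_def)
  have CV: "C \<subseteq> ?V" "card C = i" "finite C"
    using C V by (auto simp: blue_count_state_def intro: finite_subset)
  have cW: "card (?V - C) = n - i" and "i \<le> n"
    using V CV by (auto simp: card_Diff_subset intro: card_mono)
  show ?thesis
  \<comment> \<open>With all vertices blue the round is deterministic. Otherwise
    \<open>1 \<le> i < n\<close> forces \<open>n \<ge> 2\<close>, so \<open>n - 1\<close> is a
    nonzero denominator.\<close>
  proof (cases "i = n")
    case True
    then have "C = ?V"
      using V CV by (simp add: card_subset_eq)
    then have "pzf_round G C = return_pmf ?V"
      by (simp add: pzf_round_complete[OF K subset_refl])
    then show ?thesis
      using True V by (cases "j \<le> n") (auto simp: blue_count_state_def trans_prob_def)
  next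
    case False
    with \<open>i \<le> n\<close> i have n: "i \<le> n - 1" "n \<ge> 2"
      by auto
    then have r: "0 \<le> ?r" "?r \<le> 1"
      by auto
    have q: "(1 - ?r) ^ i = stay_white n i"
      using n by (simp add: stay_white_def of_nat_diff field_simps)
    have q01: "0 \<le> 1 - stay_white n i" "1 - stay_white n i \<le> 1"
      unfolding q[symmetric] using r by (auto intro: power_le_one)
    let ?P = "Pi_pmf (C \<times> (?V - C)) False (\<lambda>_. bernoulli_pmf ?r)"
      and ?F = "\<lambda>s. {w \<in> ?V - C. \<exists>u\<in>C. s (u, w)}"
    \<comment> \<open>Newly forced vertices are disjoint from \<open>C\<close>, so the final state
      depends only on their number.\<close>
    have "card (C \<union> ?F s) = i + card (?F s)" for s
      using V CV by (subst card_Un_disjoint) auto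
    then have "(\<lambda>s. C \<union> ?F s) -` blue_count_state G j = {s. i + card (?F s) = j}"
      using CV by (auto simp: blue_count_state_def)
    then have "measure_pmf.prob (pzf_round G C) (blue_count_state G j) =
      measure_pmf.prob ?P {s. i + card (?F s) = j}"
      by (simp add: pzf_round_complete[OF K CV(1)] CV(2))
    also have "{s. i + card (?F s) = j} = (\<lambda>s. card (?F s)) -` {k. i + k = j}"
      by auto
    also have "measure_pmf.prob ?P \<dots> =
      measure_pmf.prob (binomial_pmf (n - i) (1 - stay_white n i)) {k. i + k = j}"
      using map_pmf_card_forced_binomial[of C "?V - C" ?r] V CV r
      by (simp only: measure_map_pmf[symmetric] cW q finite_Diff)
    also have "{k. i + k = j} = (if i \<le> j then {j - i} else {})"
      by auto
    finally show ?thesis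
      using q01 n by (simp add: measure_pmf_single trans_prob_def)
  qed
qed

lemma blue_count_state_nonempty: "i \<le> card (verts G) \<Longrightarrow> blue_count_state G i \<noteq> {}"
  by (auto simp: blue_count_state_def elim: obtain_subset_with_card_n)

lemma blue_count_states_simps:
  "length (blue_count_states G) = card (verts G)"
  "k < card (verts G) \<Longrightarrow> blue_count_states G ! k = blue_count_state G (Suc k)"
  by (simp_all add: blue_count_states_def del: upt_Suc)

text \<open>The description by \<open>THE\<close> is well defined: the probability is the same for
  all configurations of a state, and each state is nonempty. \<open>Suc\<close> converts indices
  from 0 into blue counts from 1.\<close>

lemma pzf_matrix_complete:
  assumes K: "K\<^bsub>n\<^esub> G"
  shows "pzf_matrix G (blue_count_states G) = mat n n (\<lambda>(i, j). trans_prob n (Suc i) (Suc j))"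
proof -
  have V: "card (verts G) = n"
    using K by (simp add: complete_digraph_def)
  have "(THE p. \<forall>C \<in> blue_count_state G (Suc i).
      measure_pmf.prob (pzf_round G C) (blue_count_state G (Suc j)) = p) = trans_prob n (Suc i) (Suc j)"
    if "i < n" for i j
    using blue_count_state_nonempty[of "Suc i" G] that V
    by (intro the_equality) (auto simp: prob_pzf_round_complete[OF K])
  then show ?thesis
    by (intro eq_matI) (auto simp: pzf_matrix_def blue_count_states_simps V)
qed

text \<open>With one white vertex left every attempt succeeds surely. The exponent must be positive,
  since \<open>0 ^ 0 = 1\<close>.\<close>

lemma stay_white_pred: "1 \<le> n - 1 \<Longrightarrow> stay_white n (n - 1) = 0"
  by (simp add: stay_white_def of_nat_diff)

lemma spectrum_pzf_matrix_complete:
  assumes "K\<^bsub>n\<^esub> G" "n \<ge> 2"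
  shows "spectrum (map_mat complex_of_real (pzf_matrix G (blue_count_states G))) =
    {0, 1} \<union> {complex_of_real (((real n - 1 - real i) / (real n - 1)) ^ (i * (n - i))) | i. i \<in> {1..n - 2}}"
    (is "spectrum ?M = {0, 1} \<union> ?S")
proof -
  let ?d = "\<lambda>i. complex_of_real (stay_white n i ^ (n - i))"
  have "spectrum ?M = (\<lambda>k. ?M $$ (k, k)) ` {0..<n}"
    using assms
    by (intro spectrum_upper_triangular) (auto simp: pzf_matrix_complete trans_prob_def)
  also have "\<dots> = (\<lambda>k. ?d (Suc k)) ` {0..<n}"
    using assms by (intro image_cong) (auto simp: pzf_matrix_complete trans_prob_def)
  also have "\<dots> = ?d ` {1..n}"
    by (simp only: image_image[of ?d Suc, symmetric] image_Suc_atLeastLessThan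
        atLeastLessThanSuc_atLeastAtMost One_nat_def)
  \<comment> \<open>The index \<open>n - 1\<close> yields the eigenvalue 0, and \<open>n\<close>
    yields 1 through the exponent 0.\<close>
  also have "{1..n} = {n - 1, n} \<union> {1..n - 2}"
    using assms(2) by auto
  also have "?d ` \<dots> = {0, 1} \<union> ?d ` {1..n - 2}"
    using assms(2) stay_white_pred[of n] by (simp add: image_Un)
  also have "?d ` {1..n - 2} = ?S"
    by (auto simp: stay_white_def power_mult)
  finally show ?thesis .
qed

theorem theorem2p4:
  fixes G :: "('a, 'b) pre_digraph" and n :: nat and M :: "real mat"
    and m :: "nat \<Rightarrow> nat \<Rightarrow> real"
  assumes "n \<ge> 1" and "K\<^bsub>n\<^esub> G"
  defines "M \<equiv> pzf_matrix G (blue_count_states G)"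
  defines "m \<equiv> (\<lambda>i j. M $$ (i - 1, j - 1))"
  shows "M \<in> carrier_mat n n
    \<and> (\<forall>i \<in> {1..n}. \<forall>j \<in> {1..n}.
         (\<forall>C \<in> blue_count_state G i.
            measure_pmf.prob (pzf_round G C) (blue_count_state G j) = m i j)
       \<and> (i + 2 \<le> n \<and> i \<le> j \<longrightarrow>
            m i j = real ((n - i) choose (j - i))
              * (1 - ((real n - 1 - real i) / (real n - 1)) ^ i) ^ (j - i)
              * (((real n - 1 - real i) / (real n - 1)) ^ i) ^ (n - j))
       \<and> (j = n \<and> (i = n - 1 \<or> i = n) \<longrightarrow> m i j = 1)
       \<and> (i > j \<or> (i = j \<and> j = n - 1) \<longrightarrow> m i j = 0))
    \<and> (n \<ge> 2 \<longrightarrow>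
         spectrum (map_mat complex_of_real M) =
           {0, 1} \<union> {complex_of_real (((real n - 1 - real i) / (real n - 1)) ^ (i * (n - i)))
                     | i. i \<in> {1..n - 2}})"
proof -
  have m: "m i j = trans_prob n i j" if "i \<in> {1..n}" "j \<in> {1..n}" for i j
    using that by (auto simp: m_def M_def pzf_matrix_complete[OF assms(2)])
  have "M \<in> carrier_mat n n"
    by (simp add: M_def pzf_matrix_complete[OF assms(2)])
  moreover have "measure_pmf.prob (pzf_round G C) (blue_count_state G j) = m i j"
    if "i \<in> {1..n}" "j \<in> {1..n}" "C \<in> blue_count_state G i" for i j C
    using that m prob_pzf_round_complete[OF assms(2)] by simp
  moreover have "m i j = real ((n - i) choose (j - i))
      * (1 - ((real n - 1 - real i) / (real n - 1)) ^ i) ^ (j - i)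
      * (((real n - 1 - real i) / (real n - 1)) ^ i) ^ (n - j)"
    if "i \<in> {1..n}" "j \<in> {1..n}" "i \<le> j" for i j
    using that by (simp add: m trans_prob_def stay_white_def)
  \<comment> \<open>For \<open>i = n - 1\<close> the survival probability is 0 and its exponent
    \<open>n - j\<close> is 0; for \<open>i = n\<close> all exponents vanish.\<close>
  moreover have "m i j = 1" if "i \<in> {1..n}" "j \<in> {1..n}" "j = n" "i = n - 1 \<or> i = n" for i j
    using that stay_white_pred[of n] by (auto simp: m trans_prob_def)
  \<comment> \<open>On the diagonal at \<open>n - 1\<close> the survival probability 0 occurs with
    exponent 1.\<close>
  moreover have "m i j = 0" if "i \<in> {1..n}" "j \<in> {1..n}" "i > j \<or> (i = j \<and> j = n - 1)" for i j
    using that stay_white_pred[of n] by (auto simp: m trans_prob_def)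
  moreover note spectrum_pzf_matrix_complete[OF assms(2), folded M_def]
  ultimately show ?thesis
    by (intro conjI ballI impI; (elim conjE)?) simp_all
qed

end
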